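(* Let $\lambda$ be an infinite cardinal. For every coloring $c:[\lambda^+]^2\to\lambda$ there exists a coloring $c^+:[\lambda^+]^2\to\lambda^+$ such that for every cardinal $\mu\le\lambda$, every partition $p:[\lambda^+]^2\to\mu$, and every cardinal $\chi$ with $\lambda^{<\chi}=\lambda$: (1) if $c$ witnesses $\mathrm{pr}_1(\lambda^+,\lambda^+,\lambda,\chi)_p$ then $c^+$ witnesses $\mathrm{pr}_1(\lambda^+,\lambda^+,\lambda^+,\chi)_p$; (2) if $c$ witnesses $\mathrm{pr}_1(\lambda^+,\lambda^+\circledast\lambda^+,\lambda,\chi)_p$ then $c^+$ witnesses $\mathrm{pr}_1(\lambda^+,\lambda^+\circledast\lambda^+,\lambda^+,\chi)_p$; (3) for every cardinal $\nu$ with $\operatorname{cf}([\lambda]^\nu,\subseteq)\le\lambda$, if $c$ witnesses $\mathrm{pr}_1(\lambda^+,\lambda\circledast\lambda^+/\nu\circledast\lambda^+,\lambda,\chi)_p$ then $c^+$ witnesses $\mathrm{pr}_1(\lambda^+,\lambda\circledast\lambda^+/\nu\circledast\lambda^+,\lambda^+,\chi)_p$.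
   Context: $[\kappa]^2$ denotes the set of pairs $(\alpha,\beta)$ with $\alpha<\beta<\kappa$; a partition is any function $p:[\kappa]^2\to\mu$. $\operatorname{cf}([\lambda]^\nu,\subseteq)$ is the least size of a family $\mathcal F$ of $\nu$-sized subsets of $\lambda$ such that every $\nu$-sized subset of $\lambda$ is contained in a member of $\mathcal F$. For an ordinal $\sigma$, $[\kappa]^\sigma$ is the set of subsets of $\kappa$ of order type $\sigma$; $a<b$ means every element of $a$ is below every element of $b$; $[\mathcal A]^{\nu'}$ is the set of subfamilies of $\mathcal A$ of size $\nu'$. Given $p:[\kappa]^2\to\mu$, a coloring $c:[\kappa]^2\to\theta$ witnesses: - $\mathrm{pr}_1(\kappa,\kappa,\theta,\chi)_p$ iff for every ordinal $\sigma<\chi$, every pairwise disjoint $\mathcal A\subseteq[\kappa]^\sigma$ of size $\kappa$ and every $\tau:\mu\to\theta$ there are $a,b\in\mathcal A$, $a<b$, with $c(\alpha,\beta)=\tau(p(\alpha,\beta))$ for all $\alpha\in a,\beta\in b$; - $\mathrm{pr}_1(\kappa,\nu\circledast\kappa/\nu'\circledast\kappa,\theta,\chi)_p$ iff for every ordinal $\sigma<\chi$ and every two families $\mathcal A,\mathcal B\subseteq[\kappa]^\sigma$, each pairwise disjoint, with $|\mathcal A|=\nu$, $|\mathcal B|=\kappa$, there is $\mathcal A'\in[\mathcal A]^{\nu'}$ such that for every $\tau:\mu\to\theta$ there are $a\in\mathcal A'$, $b\in\mathcal B$, $a<b$, with $c(\alpha,\beta)=\tau(p(\alpha,\beta))$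 for all $\alpha\in a,\beta\in b$; - $\mathrm{pr}_1(\kappa,\nu\circledast\kappa,\theta,\chi)_p$ is the case $\nu'=\nu$ of the previous item. *)

theory Defs
  imports Main
begin

text \<open>Cardinals and ordinals are represented by well-order relations
(BNF_Wellorder / BNF_Cardinal library in Main): an ordinal is a well-order,
a cardinal a cardinal-order, order types are compared with ordIso/ordLess.
The cardinal kappa is represented by a well-order R; the ordinals below kappa
are the elements of Field R.\<close>

text \<open>alpha < beta in the order R (so the pair is an element of [kappa]^2).\<close>
definition pair_lt :: "'b rel \<Rightarrow> 'b \<Rightarrow> 'b \<Rightarrow> bool" where
  "pair_lt R x y \<longleftrightarrow> (x, y) \<in> R \<and> x \<noteq> y"

definition set_lt :: "'b rel \<Rightarrow> 'b set \<Rightarrow> 'b set \<Rightarrow> bool" where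
  "set_lt R a b \<longleftrightarrow> (\<forall>x\<in>a. \<forall>y\<in>b. pair_lt R x y)"

definition disj_family :: "'b rel \<Rightarrow> 'd rel \<Rightarrow> 'b set set \<Rightarrow> bool" where
  "disj_family R \<sigma> A \<longleftrightarrow>
     (\<forall>a\<in>A. a \<subseteq> Field R \<and> (Restr R a, \<sigma>) \<in> ordIso) \<and> pairwise disjnt A"

text \<open>c witnesses pr_1(kappa,kappa,theta,chi)_p, where kappa = R, theta = Theta
  (a set of colours of size theta), and p : [kappa]^2 -> M (|M| = mu).\<close>
definition pr1 :: "'b rel \<Rightarrow> 'c set \<Rightarrow> 'd rel \<Rightarrow> ('b \<Rightarrow> 'b \<Rightarrow> 'e) \<Rightarrow> 'e set
    \<Rightarrow> ('b \<Rightarrow> 'b \<Rightarrow> 'c) \<Rightarrow> bool" where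
  "pr1 R \<Theta> \<chi> p M c \<longleftrightarrow>
     (\<forall>\<sigma> :: 'd rel. Well_order \<sigma> \<and> (\<sigma>, \<chi>) \<in> ordLess \<longrightarrow>
       (\<forall>A. disj_family R \<sigma> A \<and> (card_of A, card_of (Field R)) \<in> ordIso \<longrightarrow>
         (\<forall>\<tau>. (\<forall>x\<in>M. \<tau> x \<in> \<Theta>) \<longrightarrow>
           (\<exists>a\<in>A. \<exists>b\<in>A. set_lt R a b \<and> (\<forall>\<alpha>\<in>a. \<forall>\<beta>\<in>b. c \<alpha> \<beta> = \<tau> (p \<alpha> \<beta>))))))"

definition pr1_circ :: "'b rel \<Rightarrow> 'c set \<Rightarrow> 'd rel \<Rightarrow> ('b \<Rightarrow> 'b \<Rightarrow> 'e) \<Rightarrow> 'e set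
    \<Rightarrow> ('b \<Rightarrow> 'b \<Rightarrow> 'c) \<Rightarrow> 'f rel \<Rightarrow> 'g rel \<Rightarrow> bool" where
  "pr1_circ R \<Theta> \<chi> p M c \<nu> \<nu>' \<longleftrightarrow>
     (\<forall>\<sigma> :: 'd rel. Well_order \<sigma> \<and> (\<sigma>, \<chi>) \<in> ordLess \<longrightarrow>
       (\<forall>A B. disj_family R \<sigma> A \<and> disj_family R \<sigma> B \<and>
              (card_of A, \<nu>) \<in> ordIso \<and> (card_of B, card_of (Field R)) \<in> ordIso \<longrightarrow>
         (\<exists>A'. A' \<subseteq> A \<and> (card_of A', \<nu>') \<in> ordIso \<and>
           (\<forall>\<tau>. (\<forall>x\<in>M. \<tau> x \<in> \<Theta>) \<longrightarrow>
             (\<exists>a\<in>A'. \<exists>b\<in>B. set_lt R a b \<and> (\<forall>\<alpha>\<in>a. \<forall>\<beta>\<in>b. c \<alpha> \<beta> = \<tau> (p \<alpha> \<beta>)))))))"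

text \<open>lambda^{<chi} = |[lambda]^{<chi}|: the set of subsets of L of size < chi.\<close>
definition small_subsets :: "'a set \<Rightarrow> 'd rel \<Rightarrow> 'a set set" where
  "small_subsets L \<chi> = {X. X \<subseteq> L \<and> (card_of X, \<chi>) \<in> ordLess}"

definition cf_subsets_le :: "'a set \<Rightarrow> 'd rel \<Rightarrow> bool" where
  "cf_subsets_le L \<nu> \<longleftrightarrow>
     (\<exists>F. F \<subseteq> {X. X \<subseteq> L \<and> (card_of X, \<nu>) \<in> ordIso} \<and>
          (\<forall>Y. Y \<subseteq> L \<and> (card_of Y, \<nu>) \<in> ordIso \<longrightarrow> (\<exists>X\<in>F. Y \<subseteq> X)) \<and>
          (card_of F, card_of L) \<in> ordLeq)"

end

(* Fix surjections e_\<beta> from \<lambda> onto \<beta> + 1 and, by Engelking-Karlowicz, functions h_i (i < \<lambda>)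
   from \<lambda>^+ to \<lambda> such that every function from a set of size < \<chi> to \<lambda> extends to some h_i.
   Reading a colour as a pair (i, j), let c^+(\<alpha>, \<beta>) = e_\<delta>(j) with \<delta> = e_\<beta>(h_i(\<beta>)).
   Given \<lambda> many values t < \<lambda>^+, choose \<delta> above them. For every b above \<delta> some i satisfies
   e_\<beta>(h_i(\<beta>)) = \<delta> for all \<beta> in b, and by pigeonhole one i serves \<lambda>^+ many b. On these b the
   value t = e_\<delta>(j) of c^+ is prescribed by the value (i, j) of c, independently of \<beta>.
   For (1) and (2) this suffices (in (2), A' = A). For (3), if every member X of a cofinal
   family had a bad \<tau>_X, then a single \<delta> above the ranges of all \<tau>_X gives a contradiction. *)
theory Submission
  imports Defs
begin

unbundle cardinal_syntax

section \<open>Cardinal bounds and the pigeonhole principle\<close>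

lemma card_of_finite_ordLeq_infinite:
  assumes "infinite L" "finite x"
  shows "|x| \<le>o |L|"
  using card_of_ordLeq_infinite[of L x] assms
    ordLeq_total[OF card_of_Well_order[of x] card_of_Well_order[of L]] by blast

lemma card_of_subset_ordLeq: "A \<subseteq> B \<Longrightarrow> |B| \<le>o r \<Longrightarrow> |A| \<le>o r"
  by (rule ordLeq_transitive[OF card_of_mono1])

text \<open>Were all fibres of size at most \<open>|L|\<close>, their union \<open>B\<close> would
  be too. This pigeonhole principle later selects one index for many sets \<open>b\<close>.\<close>

lemma large_fiber:
  assumes "infinite L" "\<not> |B| \<le>o |L|" "|I| \<le>o |L|" "\<And>b. b \<in> B \<Longrightarrow> f b \<in> I"
  shows "\<exists>i\<in>I. \<not> |{b \<in> B. f b = i}| \<le>o |L|"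
proof (rule ccontr)
  assume "\<not> ?thesis"
  then have "|\<Union>i\<in>I. {b \<in> B. f b = i}| \<le>o |L|"
    using assms by (intro card_of_UNION_ordLeq_infinite) auto
  moreover have "(\<Union>i\<in>I. {b \<in> B. f b = i}) = B" using assms(4) by auto
  ultimately show False using assms(2) by simp
qed

section \<open>Sets \<open>x\<close> with \<lambda>^|x| \<le> \<lambda>, and how many of them there
  are\<close>

text \<open>Goodness of \<open>x\<close> says \<open>\<lambda>\<^bsup>|x|\<^esup> \<le> \<lambda>\<close>. It avoids mentioning \<open>\<chi>\<close>, because
  \<open>c\<^sup>+\<close> has to be constructed before \<open>\<chi>\<close> is given.\<close>
definition good :: "'a set \<Rightarrow> 'b set \<Rightarrow> bool" where
  "good L x \<longleftrightarrow> |{y. y \<subseteq> L \<and> |y| \<le>o |x|}| \<le>o |L|"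

lemma good_mono:
  assumes "|y| \<le>o |x|" "good L x"
  shows "good L y"
proof -
  have "{z. z \<subseteq> L \<and> |z| \<le>o |y|} \<subseteq> {z. z \<subseteq> L \<and> |z| \<le>o |x|}"
    using ordLeq_transitive[OF _ assms(1)] by auto
  from card_of_mono1[OF this] show ?thesis
    using assms(2) unfolding good_def by (rule ordLeq_transitive)
qed

text \<open>Inserting a point into an \<open>n\<close>-element subset yields those with
  \<open>Suc n\<close> elements, so by induction \<open>L\<close> has at most \<open>|L|\<close>
  subsets of each finite size.\<close>

lemma good_finite:
  assumes "infinite L" "finite x"
  shows "good L x"
proof -
  have *: "|{y. y \<subseteq> L \<and> finite y \<and> card y = n}| \<le>o |L|" for n
  proof (induction n)
    case 0
    have "{y. y \<subseteq> L \<and> finite y \<and> card y = 0} = {{}}" by auto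
    then show ?case using assms(1)
      by (simp add: card_of_finite_ordLeq_infinite)
  next
    case (Suc n)
    let ?S = "{y. y \<subseteq> L \<and> finite y \<and> card y = n}"
    have "{y. y \<subseteq> L \<and> finite y \<and> card y = Suc n} \<subseteq> (\<lambda>(l, y). insert l y) ` (L \<times> ?S)"
      by (fastforce simp: card_Suc_eq)
    then have "|{y. y \<subseteq> L \<and> finite y \<and> card y = Suc n}| \<le>o |L \<times> ?S|"
      by (rule surj_imp_ordLeq)
    moreover have "|L \<times> ?S| \<le>o |L|"
      using Suc assms(1) by (intro card_of_Sigma_ordLeq_infinite ballI card_of_mono1[OF subset_refl])
    ultimately show ?case by (rule ordLeq_transitive)
  qed
  have "{y. y \<subseteq> L \<and> |y| \<le>o |x|} \<subseteq> (\<Union>n\<in>{..card x}. {y. y \<subseteq> L \<and> finite y \<and> card y = n})"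
  proof
    fix y assume "y \<in> {y. y \<subseteq> L \<and> |y| \<le>o |x|}"
    then have y: "y \<subseteq> L" "|y| \<le>o |x|" by auto
    then have "finite y" using assms(2) card_of_ordLeq_finite by blast
    moreover obtain f where "inj_on f y" "f ` y \<subseteq> x" using y(2) card_of_ordLeq by metis
    then have "card y \<le> card x" using assms(2) card_inj_on_le by blast
    ultimately show "y \<in> (\<Union>n\<in>{..card x}. {y. y \<subseteq> L \<and> finite y \<and> card y = n})"
      using y(1) by auto
  qed
  moreover have "|\<Union>n\<in>{..card x}. {y. y \<subseteq> L \<and> finite y \<and> card y = n}| \<le>o |L|"
    using assms(1) *
    by (intro card_of_UNION_ordLeq_infinite) (auto intro: card_of_finite_ordLeq_infinite)
  ultimately show ?thesis
    unfolding good_def by (rule card_of_subset_ordLeq)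
qed

lemma good_Times:
  assumes "infinite L" "good L x"
  shows "good L (x \<times> x)"
proof (cases "finite x")
  case True
  then show ?thesis by (intro good_finite[OF assms(1)] finite_cartesian_product)
next
  case False
  show ?thesis
    by (rule good_mono[OF ordIso_imp_ordLeq[OF card_of_Times_same_infinite[OF False]] assms(2)])
qed

text \<open>By Cantor's theorem \<open>L\<close> itself is not good, so a good subset is smaller
  than \<open>L\<close> and equinumerous with a proper initial segment of \<open>|L|\<close>. There
  are at most \<open>|L|\<close> such segments, and goodness bounds the number of subsets of each
  such size.\<close>

lemma card_of_good_subsets_self:
  assumes "infinite L"
  shows "|{y. y \<subseteq> L \<and> good L y}| \<le>o |L|"
proof -
  let ?S = "\<lambda>i. {y. y \<subseteq> L \<and> good L y \<and> |y| =o |underS ( |L| ) i|}"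
  have "{y. y \<subseteq> L \<and> good L y} \<subseteq> (\<Union>i\<in>L. ?S i)"
  proof
    fix y assume y: "y \<in> {y. y \<subseteq> L \<and> good L y}"
    have "|y| <o |L|"
    proof (rule ccontr)
      assume "\<not> |y| <o |L|"
      then have "|L| \<le>o |y|"
        using not_ordLess_iff_ordLeq[OF card_of_Well_order card_of_Well_order] by blast
      then have "good L L" using y good_mono by auto
      moreover have "{z. z \<subseteq> L \<and> |z| \<le>o |L|} = Pow L" using card_of_mono1 by auto
      ultimately have "|Pow L| \<le>o |L|" unfolding good_def by simp
      then show False using not_ordLess_ordLeq[OF card_of_Pow] by blast
    qed
    \<comment> \<open>A well-order below \<open>|L|\<close> is isomorphic to a restriction of
      \<open>|L|\<close> to some \<open>underS\<close>; comparing fields then leaves only the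
      sizes.\<close>
    then obtain i where i: "i \<in> L" "|y| =o Restr |L| (underS ( |L| ) i)"
      using iffD1[OF ordLess_iff_ordIso_Restr[OF card_of_Well_order card_of_Well_order]]
      unfolding Field_card_of by blast
    have "Field (Restr |L| (underS ( |L| ) i)) = underS ( |L| ) i"
      by (rule Field_Restr_ofilter) (simp_all add: wo_rel_def wo_rel.underS_ofilter card_of_Well_order)
    moreover have "|Field |y|| =o |Field (Restr |L| (underS ( |L| ) i))|"
      using i(2) by (rule card_of_cong)
    ultimately have "|y| =o |underS ( |L| ) i|" by (simp add: Field_card_of)
    then show "y \<in> (\<Union>i\<in>L. ?S i)" using i(1) y by auto
  qed
  moreover have "|?S i| \<le>o |L|" for i
  proof (cases "?S i = {}")
    case False
    \<comment> \<open>One member bounds the whole class: all others have the size of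
      \<open>y\<close>, and \<open>y\<close> is good.\<close>
    then obtain y where y: "y \<subseteq> L" "good L y" "|y| =o |underS ( |L| ) i|" by blast
    have "?S i \<subseteq> {z. z \<subseteq> L \<and> |z| \<le>o |y|}"
      using ordIso_imp_ordLeq[OF ordIso_transitive[OF _ ordIso_symmetric[OF y(3)]]] by auto
    from card_of_mono1[OF this] show ?thesis
      using y(2) unfolding good_def by (rule ordLeq_transitive)
  next
    case True
    then show ?thesis by (simp only: card_of_empty)
  qed
  then have "|\<Union>i\<in>L. ?S i| \<le>o |L|"
    by (intro card_of_UNION_ordLeq_infinite[OF assms] card_of_mono1[OF subset_refl] ballI)
  ultimately show ?thesis by (rule card_of_subset_ordLeq)
qed

text \<open>Images under an injection of \<open>Z\<close> into \<open>L\<close> stay good. Below,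
  \<open>Z\<close> is a set of triples over \<open>L\<close>.\<close>

lemma card_of_good_subsets:
  assumes "infinite L" "|Z| \<le>o |L|"
  shows "|{y. y \<subseteq> Z \<and> good L y}| \<le>o |L|"
proof -
  obtain f where f: "inj_on f Z" "f ` Z \<subseteq> L"
    using assms(2) card_of_ordLeq by metis
  have "inj_on ((`) f) {y. y \<subseteq> Z \<and> good L y}"
    using f(1) by (auto simp: inj_on_def inj_on_image_eq_iff[OF f(1)])
  moreover have "(`) f ` {y. y \<subseteq> Z \<and> good L y} \<subseteq> {y. y \<subseteq> L \<and> good L y}"
    using f(2) good_mono[OF card_of_image] by blast
  ultimately have "|{y. y \<subseteq> Z \<and> good L y}| \<le>o |{y. y \<subseteq> L \<and> good L y}|"
    by (intro iffD1[OF card_of_ordLeq] exI conjI)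
  then show ?thesis using card_of_good_subsets_self[OF assms(1)] by (rule ordLeq_transitive)
qed

section \<open>The Engelking-Karlowicz theorem\<close>

text \<open>Engelking--Karlowicz: for \<open>b\<close> pick a set \<open>D\<close> of points at which the
  sets \<open>r \<beta>\<close> (\<open>\<beta> \<in> b\<close>) differ pairwise; the triples \<open>(D, r \<beta> \<inter> D, f \<beta>)\<close> then
  determine a function on all of \<open>K\<close> that extends \<open>f\<close>.\<close>
lemma Engelking_Karlowicz:
  fixes L :: "'a set" and K :: "'k set"
  assumes inf: "infinite L" and r: "inj_on r K" "r ` K \<subseteq> Pow L"
  obtains h :: "'a \<Rightarrow> 'k \<Rightarrow> 'a"
  where "\<And>b f. \<lbrakk>b \<subseteq> K; good L b; f ` b \<subseteq> L\<rbrakk> \<Longrightarrow> \<exists>i\<in>L. \<forall>\<beta>\<in>b. h i \<beta> = f \<beta>"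
proof -
  let ?X = "{y. y \<subseteq> L \<and> good L y}"
  let ?Z = "?X \<times> ?X \<times> L"
  have "|?Z| \<le>o |L|"
    using card_of_good_subsets_self[OF inf] inf
    by (intro card_of_Sigma_ordLeq_infinite ballI card_of_mono1[OF subset_refl]) auto
  then have I: "|{G. G \<subseteq> ?Z \<and> good L G}| \<le>o |L|" by (rule card_of_good_subsets[OF inf])
  \<comment> \<open>The family contains the empty set, so it is an image of \<open>L\<close>:
    \<open>s\<close> enumerates all good sets of triples by indices in \<open>L\<close>.\<close>
  have "{G. G \<subseteq> ?Z \<and> good L G} \<noteq> {}" using good_finite[OF inf finite.emptyI] by blast
  from iffD2[OF card_of_ordLeq2[OF this] I] obtain s where s: "s ` L = {G. G \<subseteq> ?Z \<and> good L G}"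
    by blast
  \<comment> \<open>\<open>s i\<close> is read as a table: a triple whose second entry is the trace
    of \<open>r \<beta>\<close> on its first supplies the value. Without such a triple the value is
    arbitrary, possibly outside \<open>L\<close>.\<close>
  define h where "h i \<beta> = (SOME v. \<exists>D. (D, r \<beta> \<inter> D, v) \<in> s i)" for i \<beta>
  show thesis
  proof (rule that)
    fix b f assume b: "b \<subseteq> K" "good L b" "f ` b \<subseteq> L"
    define d where "d = (\<lambda>(x, y). SOME z. z \<in> L \<and> (z \<in> r x \<longleftrightarrow> z \<notin> r y))"
    have d: "d (x, y) \<in> L \<and> (d (x, y) \<in> r x \<longleftrightarrow> d (x, y) \<notin> r y)"
      if "x \<in> b" "y \<in> b" "x \<noteq> y" for x y
    proof -
      have "r x \<noteq> r y" using that b(1) r(1) by (auto dest: inj_onD)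
      moreover have "r x \<subseteq> L" "r y \<subseteq> L" using that b(1) r(2) by auto
      ultimately have "\<exists>z. z \<in> L \<and> (z \<in> r x \<longleftrightarrow> z \<notin> r y)" by blast
      from someI_ex[OF this] show ?thesis unfolding d_def by simp
    qed
    \<comment> \<open>Nothing separates \<open>r x\<close> from itself, so \<open>d (x, x)\<close>
      is arbitrary; the intersection with \<open>L\<close> removes such values.\<close>
    define D where "D = d ` (b \<times> b) \<inter> L"
    have "|D| \<le>o |b \<times> b|"
      unfolding D_def by (rule card_of_subset_ordLeq[OF Int_lower1 card_of_image])
    then have D: "D \<in> ?X"
      using good_mono[OF _ good_Times[OF inf b(2)]] unfolding D_def by simp
    have D': "r \<beta> \<inter> D \<in> ?X" for \<beta>
      using D good_mono[OF card_of_mono1[of "r \<beta> \<inter> D" D]] by auto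
    define G where "G = (\<lambda>\<beta>. (D, r \<beta> \<inter> D, f \<beta>)) ` b"
    have "G \<subseteq> ?Z" unfolding G_def using D D' b(3) by blast
    moreover have "good L G" unfolding G_def by (rule good_mono[OF card_of_image b(2)])
    ultimately have "G \<in> s ` L" unfolding s by (intro CollectI conjI)
    then obtain i where i: "i \<in> L" "s i = G" by blast
    have "h i \<beta> = f \<beta>" if \<beta>: "\<beta> \<in> b" for \<beta>
    proof -
      have "v = f \<beta>" if v: "(D', r \<beta> \<inter> D', v) \<in> G" for D' v
      proof -
        obtain \<gamma> where \<gamma>: "\<gamma> \<in> b" "D' = D" "r \<beta> \<inter> D = r \<gamma> \<inter> D" "v = f \<gamma>"
          using v unfolding G_def by auto
        have "\<beta> = \<gamma>"
        proof (rule ccontr)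
          assume "\<beta> \<noteq> \<gamma>"
          then have "d (\<beta>, \<gamma>) \<in> D" "d (\<beta>, \<gamma>) \<in> r \<beta> \<longleftrightarrow> d (\<beta>, \<gamma>) \<notin> r \<gamma>"
            using d[OF \<beta> \<gamma>(1)] \<beta> \<gamma>(1) unfolding D_def by auto
          then show False using \<gamma>(3) by blast
        qed
        then show ?thesis using \<gamma> by simp
      qed
      moreover have "\<exists>D'. (D', r \<beta> \<inter> D', f \<beta>) \<in> G" unfolding G_def using \<beta> by blast
      ultimately show ?thesis unfolding h_def i(2) by (intro some_equality) blast+
    qed
    then show "\<exists>i\<in>L. \<forall>\<beta>\<in>b. h i \<beta> = f \<beta>" using i(1) by blast
  qed
qed

section \<open>Sizes in disjoint families over \<lambda>^+\<close>

text \<open>Here the assumption \<lambda>^{<\<chi>} = \<lambda> enters: all subsets of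
  \<open>L\<close> of size at most \<open>|x|\<close> are counted in
  \<open>small_subsets L \<chi>\<close>.\<close>

lemma good_if_card_less:
  assumes "|small_subsets L \<chi>| =o |L|" "|x| <o \<chi>"
  shows "good L x"
proof -
  have "{y. y \<subseteq> L \<and> |y| \<le>o |x|} \<subseteq> small_subsets L \<chi>"
    unfolding small_subsets_def using ordLeq_ordLess_trans[OF _ assms(2)] by auto
  then show ?thesis
    unfolding good_def by (rule ordLeq_ordIso_trans[OF card_of_mono1 assms(1)])
qed

lemma card_of_member_disj_family:
  assumes "disj_family R \<sigma> A" "a \<in> A" "Well_order R" "Card_order \<chi>" "\<sigma> <o \<chi>"
  shows "|a| <o \<chi>"
proof -
  have a: "a \<subseteq> Field R" "Restr R a =o \<sigma>"
    using assms(1,2) unfolding disj_family_def by auto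
  have "Field (Restr R a) = a"
    using a(1) assms(3) by (auto intro!: Refl_Field_Restr2 simp: order_on_defs)
  then have "|a| \<le>o Restr R a"
    using card_of_least[of a "Restr R a"] Well_order_Restr[OF assms(3), of a] by simp
  also have "Restr R a =o \<sigma>" by (rule a(2))
  also have "\<sigma> <o \<chi>" by (rule assms(5))
  finally show ?thesis .
qed

lemma disj_family_subset:
  "disj_family R \<sigma> A \<Longrightarrow> B \<subseteq> A \<Longrightarrow> disj_family R \<sigma> B"
  unfolding disj_family_def by (blast intro: pairwise_subset)

text \<open>No cardinal lies strictly between \<open>|L|\<close> and its successor.\<close>

lemma card_of_large_subset:
  assumes "B \<subseteq> A" "|A| =o |Field (cardSuc |L| )|" "\<not> |B| \<le>o |L|"
  shows "|B| =o |Field (cardSuc |L| )|"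
proof -
  have F: "|Field (cardSuc |L| )| =o cardSuc |L|"
    by (rule card_of_Field_ordIso[OF cardSuc_Card_order[OF card_of_Card_order]])
  have "|L| <o |B|"
    using assms(3) not_ordLeq_iff_ordLess[OF card_of_Well_order card_of_Well_order] by blast
  then have "cardSuc |L| \<le>o |B|" by (simp add: cardSuc_ordLess_ordLeq[OF card_of_Card_order card_of_Card_order])
  with F have "|Field (cardSuc |L| )| \<le>o |B|" by (rule ordIso_ordLeq_trans)
  moreover have "|B| \<le>o |Field (cardSuc |L| )|"
    using card_of_mono1[OF assms(1)] assms(2) by (rule ordLeq_ordIso_trans)
  ultimately show ?thesis by (simp add: ordIso_iff_ordLeq)
qed


section \<open>Decoding a colour into an ordinal below \<lambda>^+\<close>

text \<open>\<open>d x \<beta>\<close> will be the new colour of a pair with upper point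
  \<open>\<beta>\<close> and old colour \<open>x\<close>. \<open>d\<close> is fixed before
  \<open>\<chi>\<close>, \<open>B\<close> and \<open>T\<close>; afterwards \<open>g t\<close> is a
  colour that decodes to \<open>t\<close> at all points of all sets in \<open>B'\<close>, so
  prescribing \<open>t\<close> reduces to prescribing \<open>g t\<close>.\<close>

lemma decoder:
  fixes L :: "'a set"
  defines "\<kappa> \<equiv> cardSuc |L|"
  assumes inf: "infinite L"
  obtains d :: "'a \<Rightarrow> 'a set \<Rightarrow> 'a set"
  where "\<And>x \<beta>. \<beta> \<in> Field \<kappa> \<Longrightarrow> d x \<beta> \<in> Field \<kappa>"
    and "\<And>(\<chi> :: 'd rel) \<sigma> B T.
      \<lbrakk>|small_subsets L \<chi>| =o |L|; Card_order \<chi>; \<sigma> <o \<chi>; disj_family \<kappa> \<sigma> B;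
       |B| =o |Field \<kappa>|; T \<subseteq> Field \<kappa>; |T| \<le>o |L|\<rbrakk>
      \<Longrightarrow> \<exists>B' g. B' \<subseteq> B \<and> |B'| =o |Field \<kappa>| \<and> (\<forall>t\<in>T. g t \<in> L) \<and>
        (\<forall>b\<in>B'. \<forall>\<beta>\<in>b. \<forall>t\<in>T. d (g t) \<beta> = t)"
proof -
  have \<kappa>: "Card_order \<kappa>" unfolding \<kappa>_def by (rule cardSuc_Card_order[OF card_of_Card_order])
  then have wo: "wo_rel \<kappa>" unfolding wo_rel_def card_order_on_def by auto
  have F: "|Field \<kappa>| =o \<kappa>" using \<kappa> by (rule card_of_Field_ordIso)
  have below_K: "|A| \<le>o |L|" if "|A| <o \<kappa>" for A :: "'a set set"
    using that unfolding \<kappa>_def by (simp add: cardSuc_ordLeq_ordLess[OF card_of_Card_order card_of_Card_order])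
  have not_le: "\<not> \<kappa> \<le>o |L|"
    unfolding \<kappa>_def by (rule not_ordLess_ordLeq[OF cardSuc_greater[OF card_of_Card_order]])
  have underS: "|underS \<kappa> \<beta>| \<le>o |L|" if "\<beta> \<in> Field \<kappa>" for \<beta>
    by (rule below_K[OF card_of_underS[OF \<kappa> that]])
  have under: "|under \<kappa> \<beta>| \<le>o |L|" if "\<beta> \<in> Field \<kappa>" for \<beta>
  proof -
    have "under \<kappa> \<beta> \<subseteq> {\<beta>} \<union> underS \<kappa> \<beta>" unfolding under_def underS_def by auto
    moreover have "|{\<beta>} \<union> underS \<kappa> \<beta>| \<le>o |L|"
      using inf underS[OF that]
      by (intro card_of_Un_ordLeq_infinite_Field) (auto intro: card_of_finite_ordLeq_infinite simp: Field_card_of card_of_card_order_on)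
    ultimately show ?thesis by (rule card_of_subset_ordLeq)
  qed
  have self: "\<beta> \<in> under \<kappa> \<beta>" if "\<beta> \<in> Field \<kappa>" for \<beta>
    using wo_rel.REFL[OF wo] that unfolding under_def refl_on_def by auto
  \<comment> \<open>\<open>under \<kappa> \<beta>\<close> is \<beta> + 1, never empty. The default
    \<open>\<beta>\<close> off \<open>L\<close> keeps the values in it even when \<open>h\<close>
    returns an index outside \<open>L\<close>.\<close>
  have "\<exists>f. (\<forall>x. f x \<in> under \<kappa> \<beta>) \<and> under \<kappa> \<beta> \<subseteq> f ` L" if "\<beta> \<in> Field \<kappa>" for \<beta>
  proof -
    have "under \<kappa> \<beta> \<noteq> {}" using self[OF that] by blast
    from iffD2[OF card_of_ordLeq2[OF this] under[OF that]]
    obtain f where f: "f ` L = under \<kappa> \<beta>" by blast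
    show ?thesis
      by (rule exI[of _ "\<lambda>x. if x \<in> L then f x else \<beta>"]) (use f self[OF that] in auto)
  qed
  then obtain e where e: "\<And>\<beta> x. \<beta> \<in> Field \<kappa> \<Longrightarrow> e \<beta> x \<in> under \<kappa> \<beta>"
      "\<And>\<beta>. \<beta> \<in> Field \<kappa> \<Longrightarrow> under \<kappa> \<beta> \<subseteq> e \<beta> ` L"
    by metis
  \<comment> \<open>As \<lambda>^+ \<le> 2^\<lambda>, the ordinals below \<open>\<kappa>\<close> can
    be represented by distinct subsets of \<open>L\<close>.\<close>
  have "\<kappa> \<le>o |Pow L|"
    unfolding \<kappa>_def 
    by (rule iffD1[OF cardSuc_ordLess_ordLeq[OF card_of_Card_order card_of_Card_order] card_of_Pow])
  then have "|Field \<kappa>| \<le>o |Pow L|" by (rule ordIso_ordLeq_trans[OF F])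
  from iffD2[OF card_of_ordLeq this]
  obtain r where r: "inj_on r (Field \<kappa>)" "r ` Field \<kappa> \<subseteq> Pow L" by blast
  obtain h :: "'a \<Rightarrow> 'a set \<Rightarrow> 'a"
    where h: "\<And>b f. \<lbrakk>b \<subseteq> Field \<kappa>; good L b; f ` b \<subseteq> L\<rbrakk> \<Longrightarrow> \<exists>i\<in>L. \<forall>\<beta>\<in>b. h i \<beta> = f \<beta>"
    using Engelking_Karlowicz[OF inf r] by blast
  have LL: "|L \<times> L| \<le>o |L|" by (rule ordIso_imp_ordLeq[OF card_of_Times_same_infinite[OF inf]])
  have "L \<times> L \<noteq> {}" using inf by auto
  from iffD2[OF card_of_ordLeq2[OF this] LL] obtain s where s: "s ` L = L \<times> L" by blast
  \<comment> \<open>\<open>s\<close> splits \<open>x\<close> into \<open>(i, j)\<close>: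
    \<open>h i \<beta>\<close> is a position in the enumeration of \<beta> + 1, giving \<delta>, and
    \<open>j\<close> a position in that of \<delta> + 1.\<close>
  define d where "d x \<beta> = e (e \<beta> (h (fst (s x)) \<beta>)) (snd (s x))" for x \<beta>
  have under_K: "under \<kappa> \<beta> \<subseteq> Field \<kappa>" for \<beta> unfolding under_def Field_def by auto
  show thesis
  proof (rule that[of d])
    show "d x \<beta> \<in> Field \<kappa>" if "\<beta> \<in> Field \<kappa>" for x \<beta>
      unfolding d_def using that e(1) under_K by blast
  next
    fix \<chi> :: "'d rel" and \<sigma> :: "'e rel" and B T
    assume \<chi>: "|small_subsets L \<chi>| =o |L|" "Card_order \<chi>" "\<sigma> <o \<chi>"
      and B: "disj_family \<kappa> \<sigma> B" "|B| =o |Field \<kappa>|"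
      and T: "T \<subseteq> Field \<kappa>" "|T| \<le>o |L|"
    \<comment> \<open>At most \<open>|L|\<close> initial segments, each of size at most
      \<open>|L|\<close>, cannot cover \<open>Field \<kappa>\<close>, so some
      \<open>\<delta>\<close> lies above all of \<open>T\<close>.\<close>
    have "|\<Union>t\<in>T. under \<kappa> t| \<le>o |L|"
      using inf T under by (intro card_of_UNION_ordLeq_infinite) auto
    then have "\<not> Field \<kappa> \<subseteq> (\<Union>t\<in>T. under \<kappa> t)"
      using not_le ordIso_ordLeq_trans[OF ordIso_symmetric[OF F]] card_of_subset_ordLeq by metis
    then obtain \<delta> where \<delta>: "\<delta> \<in> Field \<kappa>" "\<forall>t\<in>T. \<delta> \<notin> under \<kappa> t" by blast
    have total: "(x, y) \<in> \<kappa> \<or> (y, x) \<in> \<kappa>" if "x \<in> Field \<kappa>" "y \<in> Field \<kappa>" for x y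
      using wo_rel.TOTALS[OF wo] that by blast
    have T_\<delta>: "T \<subseteq> under \<kappa> \<delta>"
      using \<delta> T(1) total unfolding under_def by blast
    \<comment> \<open>The sets reaching below \<open>\<delta>\<close>: by disjointness, choosing
      such a point in each is injective, so there are at most \<open>|L|\<close> of them and
      discarding them is harmless.\<close>
    define B0 where "B0 = {b \<in> B. b \<inter> underS \<kappa> \<delta> \<noteq> {}}"
    have "\<forall>b\<in>B0. \<exists>x. x \<in> b \<inter> underS \<kappa> \<delta>" unfolding B0_def by blast
    from bchoice[OF this]
    obtain q where q: "\<And>b. b \<in> B0 \<Longrightarrow> q b \<in> b \<inter> underS \<kappa> \<delta>" by blast
    have "inj_on q B0"
    proof (rule inj_onI)
      fix a b assume ab: "a \<in> B0" "b \<in> B0" "q a = q b"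
      then have "\<not> disjnt a b" using q[OF ab(1)] q[OF ab(2)] unfolding disjnt_def by auto
      then show "a = b"
        using ab B(1) unfolding disj_family_def B0_def pairwise_def by blast
    qed
    moreover have "q ` B0 \<subseteq> underS \<kappa> \<delta>" using q by blast
    ultimately have "|B0| \<le>o |underS \<kappa> \<delta>|" by (intro iffD1[OF card_of_ordLeq] exI conjI)
    then have B0: "|B0| \<le>o |L|" using underS[OF \<delta>(1)] by (rule ordLeq_transitive)
    have B1: "\<not> |B - B0| \<le>o |L|"
    proof
      have K: "\<kappa> =o |B|" by (rule ordIso_symmetric[OF ordIso_transitive[OF B(2) F]])
      assume "|B - B0| \<le>o |L|"
      then have "|B0 \<union> (B - B0)| \<le>o |L|"
        using inf B0
        by (intro card_of_Un_ordLeq_infinite_Field) (auto simp: Field_card_of card_of_card_order_on)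
      moreover have "B0 \<union> (B - B0) = B" unfolding B0_def by auto
      ultimately show False using not_le ordIso_ordLeq_trans[OF K, of "|L|"] by simp
    qed
    have "\<exists>i\<in>L. \<forall>\<beta>\<in>b. e \<beta> (h i \<beta>) = \<delta>" if b: "b \<in> B - B0" for b
    proof -
      have bK: "b \<subseteq> Field \<kappa>" using b B(1) unfolding disj_family_def by auto
      have good: "good L b"
        using b wo_rel.WELL[OF wo]
        by (intro good_if_card_less[OF \<chi>(1) card_of_member_disj_family[OF B(1) _ _ \<chi>(2,3)]]) auto
      \<comment> \<open>Since \<open>\<beta>\<close> is not below \<open>\<delta>\<close>,
        \<open>\<delta>\<close> belongs to \<beta> + 1 and has a position there. These positions
        form the function on \<open>b\<close> that some \<open>h i\<close> extends.\<close>
      have "\<exists>j\<in>L. e \<beta> j = \<delta>" if "\<beta> \<in> b" for \<beta>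
      proof -
        have "\<beta> \<notin> underS \<kappa> \<delta>" using b that unfolding B0_def by blast
        then have "\<delta> \<in> under \<kappa> \<beta>"
          using total[of \<beta> \<delta>] \<delta>(1) bK that self unfolding under_def underS_def by blast
        then show ?thesis using e(2)[of \<beta>] bK that by blast
      qed
      then obtain f where f: "\<And>\<beta>. \<beta> \<in> b \<Longrightarrow> f \<beta> \<in> L \<and> e \<beta> (f \<beta>) = \<delta>" by metis
      then have "f ` b \<subseteq> L" by blast
      from h[OF bK good this] obtain i where "i \<in> L" "\<forall>\<beta>\<in>b. h i \<beta> = f \<beta>" by blast
      then show ?thesis using f by (intro bexI[of _ i]) auto
    qed
    then obtain f where f: "\<And>b. b \<in> B - B0 \<Longrightarrow> f b \<in> L"
        "\<And>b \<beta>. b \<in> B - B0 \<Longrightarrow> \<beta> \<in> b \<Longrightarrow> e \<beta> (h (f b) \<beta>) = \<delta>"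
      by metis
    obtain i where i: "i \<in> L" "\<not> |{b \<in> B - B0. f b = i}| \<le>o |L|"
      using large_fiber[OF inf B1 card_of_mono1[OF subset_refl], of f] f(1) by blast
    let ?B' = "{b \<in> B - B0. f b = i}"
    have B': "|?B'| =o |Field \<kappa>|"
      unfolding \<kappa>_def by (rule card_of_large_subset[OF _ B(2)[unfolded \<kappa>_def] i(2)]) blast
    \<comment> \<open>With \<open>i\<close> fixed, a colour for \<open>t\<close> need only add the
      position \<open>j\<close> of \<open>t\<close> in \<delta> + 1, which depends on neither
      \<open>b\<close> nor \<open>\<beta>\<close>.\<close>
    have "\<exists>x\<in>L. \<exists>j. s x = (i, j) \<and> e \<delta> j = t" if t: "t \<in> T" for t
    proof -
      obtain j where j: "j \<in> L" "e \<delta> j = t" using t T_\<delta> e(2)[OF \<delta>(1)] by blast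
      have "(i, j) \<in> s ` L" using s i(1) j(1) by simp
      then obtain x where "x \<in> L" "s x = (i, j)" by (metis imageE)
      then show ?thesis using j(2) by blast
    qed
    then obtain g where g: "\<And>t. t \<in> T \<Longrightarrow> g t \<in> L \<and> (\<exists>j. s (g t) = (i, j) \<and> e \<delta> j = t)"
      by metis
    have "\<forall>b\<in>?B'. \<forall>\<beta>\<in>b. \<forall>t\<in>T. d (g t) \<beta> = t"
    proof (intro ballI)
      fix b \<beta> t assume *: "b \<in> ?B'" "\<beta> \<in> b" "t \<in> T"
      obtain j where "s (g t) = (i, j)" "e \<delta> j = t" using g[OF *(3)] by blast
      moreover have "e \<beta> (h i \<beta>) = \<delta>" using f(2)[of b \<beta>] * by blast
      ultimately show "d (g t) \<beta> = t" unfolding d_def by simp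
    qed
    with B' g show "\<exists>B' g. B' \<subseteq> B \<and> |B'| =o |Field \<kappa>| \<and> (\<forall>t\<in>T. g t \<in> L) \<and>
        (\<forall>b\<in>B'. \<forall>\<beta>\<in>b. \<forall>t\<in>T. d (g t) \<beta> = t)"
      by (intro exI[of _ ?B'] exI[of _ g]) blast
  qed
qed

section \<open>Cofinal families of subsets\<close>

text \<open>The cofinality hypothesis concerns subsets of \<open>L\<close>, while (3) needs it for
  subfamilies of \<open>A\<close>; a bijection transports it.\<close>

lemma cofinal_family_transfer:
  assumes "cf_subsets_le L \<nu>" "|A| =o |L|"
  obtains F where "F \<subseteq> {X. X \<subseteq> A \<and> |X| =o \<nu>}" "|F| \<le>o |L|"
    "\<And>Y. Y \<subseteq> A \<Longrightarrow> |Y| =o \<nu> \<Longrightarrow> \<exists>X\<in>F. Y \<subseteq> X"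
proof -
  obtain F where F0: "F \<subseteq> {X. X \<subseteq> L \<and> |X| =o \<nu>} \<and>
      (\<forall>Y. Y \<subseteq> L \<and> |Y| =o \<nu> \<longrightarrow> (\<exists>X\<in>F. Y \<subseteq> X)) \<and> |F| \<le>o |L|"
    using assms(1) unfolding cf_subsets_le_def ..
  then have F: "F \<subseteq> {X. X \<subseteq> L \<and> |X| =o \<nu>}"
      "\<And>Y. Y \<subseteq> L \<Longrightarrow> |Y| =o \<nu> \<Longrightarrow> \<exists>X\<in>F. Y \<subseteq> X" "|F| \<le>o |L|"
    by simp_all
  obtain f where f: "bij_betw f L A"
    using ordIso_symmetric[OF assms(2)] unfolding card_of_ordIso[symmetric] ..
  have img: "|f ` X| =o |X|" if "X \<subseteq> L" for X
    using bij_betw_subset[OF f that refl] by (rule ordIso_symmetric[OF card_of_ordIsoI])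
  show thesis
  proof (rule that[of "(`) f ` F"])
    show "(`) f ` F \<subseteq> {X. X \<subseteq> A \<and> |X| =o \<nu>}"
    proof
      fix Z assume "Z \<in> (`) f ` F"
      then obtain X where X: "Z = f ` X" "X \<subseteq> L" "|X| =o \<nu>" using F(1) by blast
      then show "Z \<in> {X. X \<subseteq> A \<and> |X| =o \<nu>}"
        using ordIso_transitive[OF img[OF X(2)] X(3)] f unfolding bij_betw_def by blast
    qed
    show "|(`) f ` F| \<le>o |L|" using card_of_image F(3) by (rule ordLeq_transitive)
    fix Y assume Y: "Y \<subseteq> A" "|Y| =o \<nu>"
    define Y' where "Y' = {x \<in> L. f x \<in> Y}"
    have Y': "Y = f ` Y'" using Y(1) f unfolding Y'_def bij_betw_def by auto
    have "Y' \<subseteq> L" unfolding Y'_def by auto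
    then have "|Y'| =o |Y|" using ordIso_symmetric[OF img[of Y']] Y' by simp
    then have "|Y'| =o \<nu>" using Y(2) by (rule ordIso_transitive)
    then obtain X where "X \<in> F" "Y' \<subseteq> X" using F(2) \<open>Y' \<subseteq> L\<close> by blast
    then show "\<exists>X\<in>(`) f ` F. Y \<subseteq> X" using Y' by blast
  qed
qed

section \<open>From \<lambda> to \<lambda>^+ colours\<close>

theorem theorem3p4:
  fixes L :: "'a set" and c :: "'a set \<Rightarrow> 'a set \<Rightarrow> 'a"
  assumes "infinite L"
    and "\<forall>\<alpha> \<beta>. pair_lt (cardSuc (card_of L)) \<alpha> \<beta> \<longrightarrow> c \<alpha> \<beta> \<in> L"
  shows "\<exists>cp :: 'a set \<Rightarrow> 'a set \<Rightarrow> 'a set.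
    (\<forall>\<alpha> \<beta>. pair_lt (cardSuc (card_of L)) \<alpha> \<beta> \<longrightarrow> cp \<alpha> \<beta> \<in> Field (cardSuc (card_of L))) \<and>
    (\<forall>(M :: 'a set) (p :: 'a set \<Rightarrow> 'a set \<Rightarrow> 'a) (\<chi> :: 'a set rel).
       (card_of M, card_of L) \<in> ordLeq \<and>
       (\<forall>\<alpha> \<beta>. pair_lt (cardSuc (card_of L)) \<alpha> \<beta> \<longrightarrow> p \<alpha> \<beta> \<in> M) \<and>
       Card_order \<chi> \<and>
       (card_of (small_subsets L \<chi>), card_of L) \<in> ordIso \<longrightarrow>
         (pr1 (cardSuc (card_of L)) L \<chi> p M c \<longrightarrow>
            pr1 (cardSuc (card_of L)) (Field (cardSuc (card_of L))) \<chi> p M cp) \<and>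
         (pr1_circ (cardSuc (card_of L)) L \<chi> p M c (cardSuc (card_of L)) (cardSuc (card_of L)) \<longrightarrow>
            pr1_circ (cardSuc (card_of L)) (Field (cardSuc (card_of L))) \<chi> p M cp
              (cardSuc (card_of L)) (cardSuc (card_of L))) \<and>
         (\<forall>\<nu> :: 'a set rel. Card_order \<nu> \<and> cf_subsets_le L \<nu> \<longrightarrow>
            (pr1_circ (cardSuc (card_of L)) L \<chi> p M c (card_of L) \<nu> \<longrightarrow>
               pr1_circ (cardSuc (card_of L)) (Field (cardSuc (card_of L))) \<chi> p M cp
                 (card_of L) \<nu>)))"
proof -
  let ?\<kappa> = "cardSuc |L|"
  let ?K = "Field (cardSuc |L| )"
  obtain d :: "'a \<Rightarrow> 'a set \<Rightarrow> 'a set"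
    where dK: "\<And>x \<beta>. \<beta> \<in> ?K \<Longrightarrow> d x \<beta> \<in> ?K"
      and d: "\<And>(\<chi> :: 'a set rel) (\<sigma> :: 'a set rel) B T.
        \<lbrakk>|small_subsets L \<chi>| =o |L|; Card_order \<chi>; \<sigma> <o \<chi>; disj_family ?\<kappa> \<sigma> B;
         |B| =o |?K|; T \<subseteq> ?K; |T| \<le>o |L|\<rbrakk>
        \<Longrightarrow> \<exists>B' g. B' \<subseteq> B \<and> |B'| =o |?K| \<and> (\<forall>t\<in>T. g t \<in> L) \<and>
          (\<forall>b\<in>B'. \<forall>\<beta>\<in>b. \<forall>t\<in>T. d (g t) \<beta> = t)"
    using decoder[OF assms(1)] by blast
  define cp where "cp \<alpha> \<beta> = d (c \<alpha> \<beta>) \<beta>" for \<alpha> \<beta>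
  let ?hit = "\<lambda>c p \<tau> a b. set_lt ?\<kappa> a b \<and> (\<forall>\<alpha>\<in>a. \<forall>\<beta>\<in>b. c \<alpha> \<beta> = \<tau> (p \<alpha> \<beta>))"
  show ?thesis
  proof (intro exI[of _ cp] conjI allI impI)
    fix \<alpha> \<beta> assume "pair_lt ?\<kappa> \<alpha> \<beta>"
    then have "\<beta> \<in> ?K" unfolding pair_lt_def Field_def by auto
    then show "cp \<alpha> \<beta> \<in> ?K" unfolding cp_def by (rule dK)
  next
    fix M :: "'a set" and p :: "'a set \<Rightarrow> 'a set \<Rightarrow> 'a" and \<chi> :: "'a set rel"
    assume "|M| \<le>o |L| \<and> (\<forall>\<alpha> \<beta>. pair_lt ?\<kappa> \<alpha> \<beta> \<longrightarrow> p \<alpha> \<beta> \<in> M) \<and> Card_order \<chi> \<and>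
      |small_subsets L \<chi>| =o |L|"
    then have M: "|M| \<le>o |L|" and p: "\<And>\<alpha> \<beta>. pair_lt ?\<kappa> \<alpha> \<beta> \<Longrightarrow> p \<alpha> \<beta> \<in> M"
      and \<chi>: "Card_order \<chi>" "|small_subsets L \<chi>| =o |L|" by auto
    \<comment> \<open>\<open>set_lt\<close> puts \<open>p \<alpha> \<beta>\<close> into
      \<open>M\<close>, hence \<open>\<tau> (p \<alpha> \<beta>)\<close> into \<open>T\<close>; the
      colour \<open>g (\<tau> (p \<alpha> \<beta>))\<close> given by \<open>c\<close> is then
      decoded correctly because \<open>b\<close> lies in \<open>B'\<close>.\<close>
    have hit: "?hit cp p \<tau> a b"
      if "?hit c p (\<lambda>m. g (\<tau> m)) a b" "b \<in> B'" "\<forall>m\<in>M. \<tau> m \<in> T"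
        "\<forall>b\<in>B'. \<forall>\<beta>\<in>b. \<forall>t\<in>T. d (g t) \<beta> = t"
      for g \<tau> a b B' T
      using that p unfolding cp_def set_lt_def by metis
    have image_M: "|\<tau> ` M| \<le>o |L|" for \<tau> :: "'a \<Rightarrow> 'a set"
      using card_of_image M by (rule ordLeq_transitive)
    have image_K: "\<tau> ` M \<subseteq> ?K" if "\<forall>x\<in>M. \<tau> x \<in> ?K" for \<tau>
      using that by blast
    show "pr1 ?\<kappa> ?K \<chi> p M cp" if c: "pr1 ?\<kappa> L \<chi> p M c"
      unfolding pr1_def
    proof (intro allI impI)
      fix \<sigma> :: "'a set rel" and A \<tau>
      assume "Well_order \<sigma> \<and> \<sigma> <o \<chi>" and "disj_family ?\<kappa> \<sigma> A \<and> |A| =o |?K|"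
        and \<tau>: "\<forall>x\<in>M. \<tau> x \<in> ?K"
      then have \<sigma>: "Well_order \<sigma>" "\<sigma> <o \<chi>" and A: "disj_family ?\<kappa> \<sigma> A" "|A| =o |?K|"
        by simp_all
      \<comment> \<open>One family supplies both sets, so \<open>c\<close> is applied to the thinned
        family \<open>B\<close> on both sides.\<close>
      obtain B g where B: "B \<subseteq> A" "|B| =o |?K|" "\<forall>t\<in>\<tau> ` M. g t \<in> L"
          "\<forall>b\<in>B. \<forall>\<beta>\<in>b. \<forall>t\<in>\<tau> ` M. d (g t) \<beta> = t"
        using d[OF \<chi>(2,1) \<sigma>(2) A image_K[OF \<tau>] image_M]
        by (elim exE conjE) (rule that)
      have "\<exists>a\<in>B. \<exists>b\<in>B. ?hit c p (\<lambda>m. g (\<tau> m)) a b"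
        using c[unfolded pr1_def, rule_format, OF conjI[OF \<sigma>]
            conjI[OF disj_family_subset[OF A(1) B(1)] B(2)], of "\<lambda>m. g (\<tau> m)"] B(3) by blast
      then obtain a b where ab: "a \<in> B" "b \<in> B" "?hit c p (\<lambda>m. g (\<tau> m)) a b"
        by blast
      have "?hit cp p \<tau> a b" by (rule hit[OF ab(3,2) _ B(4)]) blast
      then show "\<exists>a\<in>A. \<exists>b\<in>A. ?hit cp p \<tau> a b"
        using ab(1,2) B(1) by blast
    qed
    show "pr1_circ ?\<kappa> ?K \<chi> p M cp ?\<kappa> ?\<kappa>" if c: "pr1_circ ?\<kappa> L \<chi> p M c ?\<kappa> ?\<kappa>"
      unfolding pr1_circ_def
    proof (intro allI impI)
      fix \<sigma> :: "'a set rel" and A B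
      assume "Well_order \<sigma> \<and> \<sigma> <o \<chi>"
        and "disj_family ?\<kappa> \<sigma> A \<and> disj_family ?\<kappa> \<sigma> B \<and> |A| =o ?\<kappa> \<and> |B| =o |?K|"
      then have \<sigma>: "Well_order \<sigma>" "\<sigma> <o \<chi>" and A: "disj_family ?\<kappa> \<sigma> A" "|A| =o ?\<kappa>"
        and B: "disj_family ?\<kappa> \<sigma> B" "|B| =o |?K|"
        by simp_all
      \<comment> \<open>\<open>B'\<close> and the subfamily \<open>A'\<close> obtained for it depend
        on \<open>\<tau>\<close>. Only the resulting pair from \<open>A\<close> and \<open>B\<close>
        is kept, so \<open>A\<close> itself is the choice uniform in \<open>\<tau>\<close>.\<close>
      have "\<exists>a\<in>A. \<exists>b\<in>B. ?hit cp p \<tau> a b" if \<tau>: "\<forall>x\<in>M. \<tau> x \<in> ?K" for \<tau>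
      proof -
        obtain B' g where B': "B' \<subseteq> B" "|B'| =o |?K|" "\<forall>t\<in>\<tau> ` M. g t \<in> L"
            "\<forall>b\<in>B'. \<forall>\<beta>\<in>b. \<forall>t\<in>\<tau> ` M. d (g t) \<beta> = t"
          using d[OF \<chi>(2,1) \<sigma>(2) B image_K[OF \<tau>] image_M]
        by (elim exE conjE) (rule that)
        have "\<exists>A'. A' \<subseteq> A \<and> |A'| =o ?\<kappa> \<and> (\<forall>\<tau>. (\<forall>x\<in>M. \<tau> x \<in> L) \<longrightarrow>
            (\<exists>a\<in>A'. \<exists>b\<in>B'. ?hit c p \<tau> a b))"
          by (rule c[unfolded pr1_circ_def, rule_format, OF conjI[OF \<sigma>]])
            (intro conjI A B'(2) disj_family_subset[OF B(1) B'(1)])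
        then obtain A' where A': "A' \<subseteq> A"
            "\<forall>\<tau>. (\<forall>x\<in>M. \<tau> x \<in> L) \<longrightarrow> (\<exists>a\<in>A'. \<exists>b\<in>B'. ?hit c p \<tau> a b)"
          by (elim exE conjE) (rule that)
        obtain a b where ab: "a \<in> A'" "b \<in> B'" "?hit c p (\<lambda>m. g (\<tau> m)) a b"
          using A'(2)[THEN spec, THEN mp, of "\<lambda>m. g (\<tau> m)"] B'(3) by blast
        have "?hit cp p \<tau> a b" by (rule hit[OF ab(3,2) _ B'(4)]) blast
        then show ?thesis using ab(1,2) A'(1) B'(1) by blast
      qed
      then show "\<exists>A'. A' \<subseteq> A \<and> |A'| =o ?\<kappa> \<and> (\<forall>\<tau>. (\<forall>x\<in>M. \<tau> x \<in> ?K) \<longrightarrow>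
          (\<exists>a\<in>A'. \<exists>b\<in>B. ?hit cp p \<tau> a b))"
        using A(2) by blast
    qed
    show "pr1_circ ?\<kappa> ?K \<chi> p M cp |L| \<nu>"
      if \<nu>: "Card_order \<nu> \<and> cf_subsets_le L \<nu>" and c: "pr1_circ ?\<kappa> L \<chi> p M c |L| \<nu>"
      for \<nu> :: "'a set rel"
      unfolding pr1_circ_def
    proof (intro allI impI)
      fix \<sigma> :: "'a set rel" and A B
      assume "Well_order \<sigma> \<and> \<sigma> <o \<chi>"
        and "disj_family ?\<kappa> \<sigma> A \<and> disj_family ?\<kappa> \<sigma> B \<and> |A| =o |L| \<and> |B| =o |?K|"
      then have \<sigma>: "Well_order \<sigma>" "\<sigma> <o \<chi>" and A: "disj_family ?\<kappa> \<sigma> A" "|A| =o |L|"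
        and B: "disj_family ?\<kappa> \<sigma> B" "|B| =o |?K|"
        by simp_all
      obtain F where F: "F \<subseteq> {X. X \<subseteq> A \<and> |X| =o \<nu>}" "|F| \<le>o |L|"
          "\<And>Y. Y \<subseteq> A \<Longrightarrow> |Y| =o \<nu> \<Longrightarrow> \<exists>X\<in>F. Y \<subseteq> X"
        using cofinal_family_transfer[OF conjunct2[OF \<nu>] A(2)] by blast
      define H where "H X \<tau> \<longleftrightarrow> (\<exists>a\<in>X. \<exists>b\<in>B. ?hit cp p \<tau> a b)" for X \<tau>
      \<comment> \<open>The subfamily must precede \<open>\<tau>\<close>, but thinning
        \<open>B\<close> depends on the values of \<open>\<tau>\<close>. Restricting the search to
        \<open>F\<close> leaves at most \<open>|L|\<close> potential counterexamples, whose values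
        fit into one \<open>T\<close>.\<close>
      have "\<exists>A'\<in>F. \<forall>\<tau>. (\<forall>x\<in>M. \<tau> x \<in> ?K) \<longrightarrow> H A' \<tau>"
      proof (rule ccontr)
        assume "\<not> ?thesis"
        then have "\<forall>X\<in>F. \<exists>\<tau>. (\<forall>x\<in>M. \<tau> x \<in> ?K) \<and> \<not> H X \<tau>"
          by blast
        then obtain \<tau> where \<tau>: "\<forall>X\<in>F. (\<forall>x\<in>M. \<tau> X x \<in> ?K) \<and> \<not> H X (\<tau> X)"
          by (rule bchoice[THEN exE])
        define T where "T = (\<Union>X\<in>F. \<tau> X ` M)"
        have T: "T \<subseteq> ?K" unfolding T_def using \<tau> by blast
        have "|T| \<le>o |L|"
          unfolding T_def
          by (intro card_of_UNION_ordLeq_infinite[OF assms(1)] F(2) ballI image_M)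
        from d[OF \<chi>(2,1) \<sigma>(2) B T this] obtain B' g where B': "B' \<subseteq> B" "|B'| =o |?K|" "\<forall>t\<in>T. g t \<in> L"
            "\<forall>b\<in>B'. \<forall>\<beta>\<in>b. \<forall>t\<in>T. d (g t) \<beta> = t"
          by (elim exE conjE)
        have "\<exists>A'. A' \<subseteq> A \<and> |A'| =o \<nu> \<and> (\<forall>\<tau>. (\<forall>x\<in>M. \<tau> x \<in> L) \<longrightarrow>
            (\<exists>a\<in>A'. \<exists>b\<in>B'. ?hit c p \<tau> a b))"
          by (rule c[unfolded pr1_circ_def, rule_format, OF conjI[OF \<sigma>]])
            (intro conjI A B'(2) disj_family_subset[OF B(1) B'(1)])
        then obtain A' where A': "A' \<subseteq> A" "|A'| =o \<nu>"
            "\<forall>\<tau>. (\<forall>x\<in>M. \<tau> x \<in> L) \<longrightarrow> (\<exists>a\<in>A'. \<exists>b\<in>B'. ?hit c p \<tau> a b)"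
          by (elim exE conjE) (rule that)
        \<comment> \<open>Enlarging \<open>A'\<close> to a member of \<open>F\<close> preserves
          success, so \<open>\<tau> X\<close> succeeds on \<open>X\<close> after all.\<close>
        obtain X where X: "X \<in> F" "A' \<subseteq> X" using F(3) A'(1,2) by blast
        have XT: "\<forall>m\<in>M. \<tau> X m \<in> T" unfolding T_def using X(1) by blast
        then obtain a b where ab: "a \<in> A'" "b \<in> B'" "?hit c p (\<lambda>m. g (\<tau> X m)) a b"
          using A'(3)[THEN spec, THEN mp, of "\<lambda>m. g (\<tau> X m)"] B'(3) by blast
        have "?hit cp p (\<tau> X) a b" by (rule hit[OF ab(3,2) XT B'(4)])
        then have "H X (\<tau> X)" unfolding H_def using X(2) ab(1,2) B'(1) by blast
        then show False using \<tau> X(1) by blast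
      qed
      then obtain A' where "A' \<in> F" "\<forall>\<tau>. (\<forall>x\<in>M. \<tau> x \<in> ?K) \<longrightarrow> H A' \<tau>"
        by blast
      moreover from this(1) have "A' \<subseteq> A" "|A'| =o \<nu>" using F(1) by auto
      ultimately show "\<exists>A'. A' \<subseteq> A \<and> |A'| =o \<nu> \<and> (\<forall>\<tau>. (\<forall>x\<in>M. \<tau> x \<in> ?K) \<longrightarrow>
          (\<exists>a\<in>A'. \<exists>b\<in>B. ?hit cp p \<tau> a b))"
        unfolding H_def by (intro exI[of _ A'] conjI)
    qed
  qed
qed

end
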